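(* Let $f:A^*\to\mathbb N$ associate to each word $w$ the maximum length of a strictly decreasing subsequence (subword) of $w$. (i) For $u,v\in A^*$, $u\equiv^l_f v$ if and only if $u\cdot\emptyset=v\cdot\emptyset$, where $\emptyset$ is the empty column. (ii) The syntactic congruence $\equiv_f$ coincides with $\equiv_{styl}$, so the syntactic monoid of $f$ is $\mathrm{Styl}(A)$.
   Context: $A$ is a finite totally ordered alphabet. A column is a subset of $A$, identified with the strictly decreasing word of its elements. For a column $\gamma$ and a letter $x$: if $x>y$ for all $y\in\gamma$, $x\cdot\gamma=\gamma\cup\{x\}$; otherwise with $y$ the smallest element of $\gamma$ with $y\geq x$, $x\cdot\gamma=(\gamma\setminus\{y\})\cup\{x\}$; this extends to a left action of $A^*$ on columns by $(uv)\cdot\gamma=u\cdot(v\cdot\gamma)$. $u\equiv_{styl}v$ iff $u\cdot\gamma=v\cdot\gamma$ for all columns $\gamma$, and $\mathrm{Styl}(A)=A^*/\equiv_{styl}$. For a function $f$ on $A^*$, the syntactic congruence is $u\equiv_f v$ iff $f(xuy)=f(xvy)$ for all $x,y\in A^*$, the syntactic monoid is $A^*/\equiv_f$, and the left syntactic congruence is $u\equiv^l_f v$ iff $f(xu)=f(xv)$ for all $x\in A^*$. *)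

theory Defs
  imports "HOL-Library.Sublist" "HOL-Algebra.Group"
begin

(* The alphabet is a finite subset A of a linearly ordered type (so that the empty
   alphabet is included); A* is "lists A", with concatenation as multiplication.
   Columns are the subsets of A. *)

definition letter_act :: "'a::linorder \<Rightarrow> 'a set \<Rightarrow> 'a set" where
  "letter_act x \<gamma> =
    (if \<forall>y\<in>\<gamma>. y < x then insert x \<gamma>
     else insert x (\<gamma> - {Min {y\<in>\<gamma>. x \<le> y}}))"

(* A left action: the last letter of the word acts first. *)
definition word_act :: "'a::linorder list \<Rightarrow> 'a set \<Rightarrow> 'a set" where
  "word_act w \<gamma> = foldr letter_act w \<gamma>"

definition styl_cong :: "'a::linorder set \<Rightarrow> 'a list rel" where
  "styl_cong A = {(u, v). u \<in> lists A \<and> v \<in> lists A \<and>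
     (\<forall>\<gamma>. \<gamma> \<subseteq> A \<longrightarrow> word_act u \<gamma> = word_act v \<gamma>)}"

definition syntactic_cong :: "'a set \<Rightarrow> ('a list \<Rightarrow> 'b) \<Rightarrow> 'a list rel" where
  "syntactic_cong A f = {(u, v). u \<in> lists A \<and> v \<in> lists A \<and>
     (\<forall>x\<in>lists A. \<forall>y\<in>lists A. f (x @ u @ y) = f (x @ v @ y))}"

definition left_syntactic_cong :: "'a set \<Rightarrow> ('a list \<Rightarrow> 'b) \<Rightarrow> 'a list rel" where
  "left_syntactic_cong A f = {(u, v). u \<in> lists A \<and> v \<in> lists A \<and>
     (\<forall>x\<in>lists A. f (x @ u) = f (x @ v))}"

(* The union over representatives in the product is a single class when R is a
   congruence; see monoid_word_quotient below. *)
definition word_quotient :: "'a set \<Rightarrow> 'a list rel \<Rightarrow> 'a list set monoid" where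
  "word_quotient A R =
    \<lparr>carrier = lists A // R,
     mult = (\<lambda>X Y. \<Union>u\<in>X. \<Union>v\<in>Y. R `` {u @ v}),
     one = R `` {[]}\<rparr>"

definition Styl :: "'a::linorder set \<Rightarrow> 'a list set monoid" where
  "Styl A = word_quotient A (styl_cong A)"

definition syntactic_monoid :: "'a set \<Rightarrow> ('a list \<Rightarrow> 'b) \<Rightarrow> 'a list set monoid" where
  "syntactic_monoid A f = word_quotient A (syntactic_cong A f)"

definition max_decreasing :: "'a::linorder list \<Rightarrow> nat" where
  "max_decreasing w = Max (length ` {s. subseq s w \<and> sorted_wrt (>) s})"


definition word_congruence :: "'a set \<Rightarrow> 'a list rel \<Rightarrow> bool" where
  "word_congruence A R \<longleftrightarrow> equiv (lists A) R \<and>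
     (\<forall>u u' v v'. (u, u') \<in> R \<longrightarrow> (v, v') \<in> R \<longrightarrow> (u @ v, u' @ v') \<in> R)"

lemma word_quotient_mult:
  assumes "word_congruence A R" "u \<in> lists A" "v \<in> lists A"
  shows "R `` {u} \<otimes>\<^bsub>word_quotient A R\<^esub> R `` {v} = R `` {u @ v}"
proof -
  have e: "equiv (lists A) R"
    and c: "\<And>u u' v v'. (u, u') \<in> R \<Longrightarrow> (v, v') \<in> R \<Longrightarrow> (u @ v, u' @ v') \<in> R"
    using assms(1) by (auto simp: word_congruence_def)
  have k: "R `` {u' @ v'} = R `` {u @ v}" if "u' \<in> R `` {u}" "v' \<in> R `` {v}" for u' v'
    using c[of u u' v v'] equiv_class_eq[OF e] that by simp
  have "u \<in> R `` {u}" "v \<in> R `` {v}"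
    using equiv_class_self[OF e] assms by blast+
  then have "(\<Union>u'\<in>R `` {u}. \<Union>v'\<in>R `` {v}. R `` {u' @ v'}) = R `` {u @ v}"
    using k by (metis (no_types, lifting) SUP_eq_const empty_iff)
  then show ?thesis
    by (simp add: word_quotient_def)
qed

lemma monoid_word_quotient:
  assumes "word_congruence A R"
  shows "monoid (word_quotient A R)"
proof -
  note m = word_quotient_mult[OF assms]
  have one: "\<one>\<^bsub>word_quotient A R\<^esub> = R `` {[]}"
    and car: "carrier (word_quotient A R) = (\<lambda>u. R `` {u}) ` lists A"
    by (auto simp: word_quotient_def quotient_def)
  have ap: "\<And>u v. u \<in> lists A \<Longrightarrow> v \<in> lists A \<Longrightarrow> u @ v \<in> lists A" by simp
  have n: "[] \<in> lists A" by simp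
  show ?thesis
  proof (rule monoidI)
    fix x y assume "x \<in> carrier (word_quotient A R)" "y \<in> carrier (word_quotient A R)"
    then obtain u v where uv: "u \<in> lists A" "v \<in> lists A" "x = R `` {u}" "y = R `` {v}"
      unfolding car by blast
    show "x \<otimes>\<^bsub>word_quotient A R\<^esub> y \<in> carrier (word_quotient A R)"
      unfolding uv(3,4) m[OF uv(1,2)] car by (rule imageI[OF ap[OF uv(1,2)]])
  next
    show "\<one>\<^bsub>word_quotient A R\<^esub> \<in> carrier (word_quotient A R)"
      unfolding car one by (rule imageI[OF n])
  next
    fix x y z assume "x \<in> carrier (word_quotient A R)" "y \<in> carrier (word_quotient A R)"
      "z \<in> carrier (word_quotient A R)"
    then show "x \<otimes>\<^bsub>word_quotient A R\<^esub> y \<otimes>\<^bsub>word_quotient A R\<^esub> z =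
       x \<otimes>\<^bsub>word_quotient A R\<^esub> (y \<otimes>\<^bsub>word_quotient A R\<^esub> z)"
      unfolding car by (elim imageE) (simp only: m ap append_assoc)
  next
    fix x assume "x \<in> carrier (word_quotient A R)"
    then show "\<one>\<^bsub>word_quotient A R\<^esub> \<otimes>\<^bsub>word_quotient A R\<^esub> x = x"
      "x \<otimes>\<^bsub>word_quotient A R\<^esub> \<one>\<^bsub>word_quotient A R\<^esub> = x"
      unfolding car one by (elim imageE, simp only: m n append_Nil append_Nil2)+
  qed
qed

lemma word_congruence_syntactic: "word_congruence A (syntactic_cong A f)"
  unfolding word_congruence_def
proof (intro conjI allI impI)
  show "equiv (lists A) (syntactic_cong A f)"
    by (rule equivI) (auto simp: syntactic_cong_def refl_on_def sym_def trans_def)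
next
  fix u u' v v'
  assume a: "(u, u') \<in> syntactic_cong A f" "(v, v') \<in> syntactic_cong A f"
  then have l: "u \<in> lists A" "u' \<in> lists A" "v \<in> lists A" "v' \<in> lists A"
    by (auto simp: syntactic_cong_def)
  have "f (x @ (u @ v) @ y) = f (x @ (u' @ v') @ y)"
    if "x \<in> lists A" "y \<in> lists A" for x y
  proof -
    have 1: "v @ y \<in> lists A" "x @ u' \<in> lists A" using that l by simp_all
    have "f (x @ u @ (v @ y)) = f (x @ u' @ (v @ y))"
      using a(1) that(1) 1(1) unfolding syntactic_cong_def by blast
    moreover have "f ((x @ u') @ v @ y) = f ((x @ u') @ v' @ y)"
      using a(2) that(2) 1(2) unfolding syntactic_cong_def by blast
    ultimately show ?thesis by simp
  qed
  then show "(u @ v, u' @ v') \<in> syntactic_cong A f"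
    using l unfolding syntactic_cong_def by simp
qed

lemma word_act_append: "word_act (u @ v) \<gamma> = word_act u (word_act v \<gamma>)"
  by (simp add: word_act_def)

lemma word_act_subset: "w \<in> lists A \<Longrightarrow> \<gamma> \<subseteq> A \<Longrightarrow> word_act w \<gamma> \<subseteq> A"
  by (induction w) (auto simp: word_act_def letter_act_def split: if_splits)

lemma word_congruence_styl: "word_congruence A (styl_cong A)"
  unfolding word_congruence_def
proof (intro conjI allI impI)
  show "equiv (lists A) (styl_cong A)"
    by (rule equivI) (auto simp: styl_cong_def refl_on_def sym_def trans_def)
next
  fix u u' v v'
  assume "(u, u') \<in> styl_cong A" "(v, v') \<in> styl_cong A"
  then show "(u @ v, u' @ v') \<in> styl_cong A"
    by (auto simp: styl_cong_def word_act_append word_act_subset)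
qed

end

theory Submission
  imports Defs
begin

text \<open>
  The action on the empty column is patience sorting: the number of elements of \<open>w\<cdot>\<emptyset>\<close>
  lying in a down-closed set \<open>D\<close> is the maximal length of a decreasing subword of \<open>w\<close>
  with letters in \<open>D\<close>. For \<open>D = UNIV\<close> this gives \<open>f(w) = |w\<cdot>\<emptyset>|\<close>, hence
  \<open>f(xuy) = |x\<cdot>(u\<cdot>(y\<cdot>\<emptyset>))|\<close>.
  Conversely, if \<open>x\<close> lists all letters above \<open>z\<close> in decreasing order, then \<open>|x\<cdot>\<gamma>|\<close> determines
  the number of elements of \<open>\<gamma>\<close> up to \<open>z\<close>, so the numbers \<open>|x\<cdot>\<gamma>|\<close> together determine \<open>\<gamma>\<close>.
  Finally every column is of the form \<open>y\<cdot>\<emptyset>\<close>.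
\<close>

section \<open>The letter action on finite columns\<close>

lemma word_act_simps [simp]:
  "word_act [] \<gamma> = \<gamma>"
  "word_act (x # w) \<gamma> = letter_act x (word_act w \<gamma>)"
  by (simp_all add: word_act_def)

lemma finite_letter_act [simp]: "finite \<gamma> \<Longrightarrow> finite (letter_act x \<gamma>)"
  by (simp add: letter_act_def)

lemma finite_word_act [simp]: "finite \<gamma> \<Longrightarrow> finite (word_act w \<gamma>)"
  by (induction w) simp_all

text \<open>Trades \<open>Min\<close> for its defining property; finiteness ensures that the minimum
  is attained. A letter \<open>x\<close> already in \<gamma> bumps itself unless all of \<gamma> is
  below \<open>x\<close>, which is then impossible, so \<open>m = x\<close> is allowed.\<close>

lemma letter_act_cases [consumes 1, case_names greatest bump]:
  fixes x :: "'a::linorder"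
  assumes "finite \<gamma>"
  obtains (greatest) "\<gamma> \<subseteq> {..<x}" "letter_act x \<gamma> = insert x \<gamma>"
  | (bump) m where "m \<in> \<gamma>" "x \<le> m" "\<And>y. y \<in> \<gamma> \<Longrightarrow> x \<le> y \<Longrightarrow> m \<le> y"
      "letter_act x \<gamma> = insert x (\<gamma> - {m})"
proof (cases "\<forall>y\<in>\<gamma>. y < x")
  case True
  then show ?thesis
    using greatest by (auto simp: letter_act_def)
next
  case False
  let ?M = "{y \<in> \<gamma>. x \<le> y}"
  have fin: "finite ?M" and ne: "?M \<noteq> {}"
    using False assms by auto
  have "Min ?M \<in> ?M"
    using Min_in[OF fin ne] .
  moreover have "Min ?M \<le> y" if "y \<in> \<gamma>" "x \<le> y" for y
    using fin that by simp
  ultimately show ?thesis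
    using bump[of "Min ?M"] False by (auto simp: letter_act_def)
qed

section \<open>Columns and longest decreasing subwords\<close>

text \<open>The right-hand side has the shape of the recursion for longest decreasing subwords in
  \<open>D\<close> when \<open>x\<close> is prefixed: either \<open>x\<close> is skipped, or it
  comes first and the rest lies below \<open>x\<close>. Bumping swaps \<open>m\<close> for some
  \<open>x \<le> m\<close>, so \<open>D\<close> being down-closed rules out that only
  \<open>m\<close> lies in \<open>D\<close>.\<close>

lemma card_letter_act_Int:
  fixes x :: "'a::linorder"
  assumes fin: "finite \<gamma>" and down: "\<And>a b. b \<in> D \<Longrightarrow> a \<le> b \<Longrightarrow> a \<in> D"
  shows "card (letter_act x \<gamma> \<inter> D) =
    (if x \<in> D then max (card (\<gamma> \<inter> D)) (Suc (card (\<gamma> \<inter> {..<x}))) else card (\<gamma> \<inter> D))"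
  using fin
proof (cases rule: letter_act_cases[where x = x])
  case greatest
  have "\<gamma> \<inter> D = \<gamma>" if "x \<in> D"
    using that greatest(1) down by (auto dest: less_imp_le)
  moreover have "\<gamma> \<inter> {..<x} = \<gamma>" "x \<notin> \<gamma>"
    using greatest(1) by auto
  ultimately show ?thesis
    using fin greatest(2) by simp
next
  case (bump m)
  consider "x \<notin> D" | "m \<in> D" | "x \<in> D" "m \<notin> D" by blast
  then show ?thesis
  proof cases
    case 1
    then have "m \<notin> D"
      using down bump(2) by blast
    then have "letter_act x \<gamma> \<inter> D = \<gamma> \<inter> D"
      using 1 bump(4) by auto
    then show ?thesis using 1 by simp
  next
    case 2
    then have x: "x \<in> D"
      using down bump(2) by blast
    \<comment> \<open>The slot freed by \<open>m\<close> makes the second argument of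
      \<open>max\<close> at most the first.\<close>
    have sub: "\<gamma> \<inter> {..<x} \<subseteq> \<gamma> \<inter> D - {m}"
      using x down bump(2) by (auto dest: less_imp_le)
    have m: "card (\<gamma> \<inter> D) = Suc (card (\<gamma> \<inter> D - {m}))"
      using 2 bump(1) fin by (intro card.remove) auto
    \<comment> \<open>If \<open>x\<close> is in \<gamma>, minimality of \<open>m\<close> forces
      \<open>m = x\<close>; hence the insertion restores exactly the one element removed.\<close>
    have "x \<notin> \<gamma> - {m}"
      using bump(2,3) by fastforce
    then have "card (letter_act x \<gamma> \<inter> D) = Suc (card ((\<gamma> - {m}) \<inter> D))"
      using x fin bump(4) by simp
    also have "(\<gamma> - {m}) \<inter> D = \<gamma> \<inter> D - {m}" by auto
    finally have "card (letter_act x \<gamma> \<inter> D) = card (\<gamma> \<inter> D)"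
      using m by simp
    moreover have "card (\<gamma> \<inter> {..<x}) \<le> card (\<gamma> \<inter> D - {m})"
      using sub fin by (intro card_mono) auto
    ultimately show ?thesis
      using x m by simp
  next
    case 3
    \<comment> \<open>An element of \<gamma> in \<open>D\<close> that is at least \<open>x\<close>
      would be at least \<open>m\<close> and put \<open>m\<close> into \<open>D\<close>.\<close>
    have eq: "\<gamma> \<inter> D = \<gamma> \<inter> {..<x}"
      using 3 down bump(3) by (auto dest: less_imp_le) (meson not_less)
    have "letter_act x \<gamma> \<inter> D = insert x (\<gamma> \<inter> {..<x})"
      using 3 eq bump(4) by auto
    then show ?thesis
      using 3 eq fin by simp
  qed
qed

text \<open>Induction with \<open>D\<close> arbitrary: if the subword starts with the first letter
  \<open>x\<close>, its tail lies in \<open>{..<x}\<close>, and the induction hypothesis is needed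
  for that set instead of \<open>D\<close>.\<close>

lemma decreasing_subseq_length_le:
  fixes w :: "'a::linorder list"
  assumes "subseq s w" "sorted_wrt (>) s" "set s \<subseteq> D"
    and "\<And>a b. b \<in> D \<Longrightarrow> a \<le> b \<Longrightarrow> a \<in> D"
  shows "length s \<le> card (word_act w {} \<inter> D)"
  using assms
proof (induction w arbitrary: s D rule: list.induct)
  case Nil
  then show ?case by simp
next
  case (Cons x w)
  have card: "card (word_act (x # w) {} \<inter> D) =
    (if x \<in> D then max (card (word_act w {} \<inter> D)) (Suc (card (word_act w {} \<inter> {..<x})))
     else card (word_act w {} \<inter> D))"
    using card_letter_act_Int[OF _ Cons.prems(4)] by simp
  show ?case
  proof (cases "\<exists>s'. s = x # s' \<and> subseq s' w")
    case True
    then obtain s' where s: "s = x # s'" "subseq s' w" by blast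
    have "length s' \<le> card (word_act w {} \<inter> {..<x})"
      using Cons.prems(2) s by (intro Cons.IH) auto
    then show ?thesis
      using s Cons.prems(3) unfolding card by simp
  next
    case False
    then have "subseq s w"
      using Cons.prems(1) by (cases s) (auto split: if_splits)
    then have "length s \<le> card (word_act w {} \<inter> D)"
      using Cons.prems by (intro Cons.IH)
    then show ?thesis unfolding card by (simp add: le_max_iff_disj)
  qed
qed

text \<open>The witness follows whichever argument of \<open>max\<close> is attained: keep the old
  subword in \<open>D\<close>, or put \<open>x\<close> in front of an optimal one in
  \<open>{..<x}\<close>.\<close>

lemma decreasing_subseq_length_attained:
  fixes w :: "'a::linorder list"
  assumes "\<And>a b. b \<in> D \<Longrightarrow> a \<le> b \<Longrightarrow> a \<in> D"
  shows "\<exists>s. subseq s w \<and> sorted_wrt (>) s \<and> set s \<subseteq> D \<and> length s = card (word_act w {} \<inter> D)"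
  using assms
proof (induction w arbitrary: D)
  case Nil
  then show ?case by simp
next
  case (Cons x w)
  have card: "card (word_act (x # w) {} \<inter> D) =
    (if x \<in> D then max (card (word_act w {} \<inter> D)) (Suc (card (word_act w {} \<inter> {..<x})))
     else card (word_act w {} \<inter> D))"
    using card_letter_act_Int[OF _ Cons.prems] by simp
  then consider "card (word_act (x # w) {} \<inter> D) = card (word_act w {} \<inter> D)"
    | "x \<in> D" "card (word_act (x # w) {} \<inter> D) = Suc (card (word_act w {} \<inter> {..<x}))"
    by (auto simp: max_def split: if_splits)
  then show ?case
  proof cases
    case 1
    obtain s where s: "subseq s w" "sorted_wrt (>) s" "set s \<subseteq> D"
      "length s = card (word_act w {} \<inter> D)"
      using Cons.IH[of D] Cons.prems by blast
    from s(1) have "subseq s (x # w)" by (rule list_emb_Cons)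
    with s 1 show ?thesis by metis
  next
    case 2
    obtain s where s: "subseq s w" "sorted_wrt (>) s" "set s \<subseteq> {..<x}"
      "length s = card (word_act w {} \<inter> {..<x})"
      using Cons.IH[of "{..<x}"] le_less_trans by (metis lessThan_iff)
    have "set s \<subseteq> D"
      using s(3) 2(1) Cons.prems by (auto dest!: subsetD less_imp_le)
    then have "subseq (x # s) (x # w) \<and> sorted_wrt (>) (x # s) \<and> set (x # s) \<subseteq> D \<and>
        length (x # s) = card (word_act (x # w) {} \<inter> D)"
      using s 2 by auto
    then show ?thesis by blast
  qed
qed

lemma max_decreasing_eq_card: "max_decreasing w = card (word_act w {})"
  unfolding max_decreasing_def
proof (rule Max_eqI)
  \<comment> \<open>\<open>Max\<close> is characterised only on finite sets; \<open>subseqs\<close>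
    enumerates all subwords.\<close>
  have "finite (set (subseqs w))" by simp
  then have "finite {s. subseq s w}"
    by (simp add: subseqs_powset flip: in_set_subseqs)
  then show "finite (length ` {s. subseq s w \<and> sorted_wrt (>) s})"
    by simp
  show "n \<le> card (word_act w {})" if "n \<in> length ` {s. subseq s w \<and> sorted_wrt (>) s}" for n
    using that decreasing_subseq_length_le[where D = UNIV] by auto
  show "card (word_act w {}) \<in> length ` {s. subseq s w \<and> sorted_wrt (>) s}"
    using decreasing_subseq_length_attained[of UNIV w] by force
qed

section \<open>Recovering a column from cardinalities\<close>

text \<open>The last letter acts first, so the letters arrive in increasing order. Each bumps only
  something at least as large as itself, hence neither an earlier arrival nor an element up to
  \<open>z\<close>.\<close>

lemma word_act_decreasing:
  fixes xs :: "'a::linorder list"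
  assumes "sorted_wrt (>) xs" "finite \<gamma>" "\<And>x. x \<in> set xs \<Longrightarrow> z < x"
  shows "set xs \<subseteq> word_act xs \<gamma>" "word_act xs \<gamma> \<inter> {..z} = \<gamma> \<inter> {..z}"
proof -
  have "set xs \<subseteq> word_act xs \<gamma> \<and> word_act xs \<gamma> \<inter> {..z} = \<gamma> \<inter> {..z}"
    using assms(1,3)
  proof (induction xs)
    case Nil
    then show ?case by simp
  next
    case (Cons x xs)
    then have IH: "set xs \<subseteq> word_act xs \<gamma>" "word_act xs \<gamma> \<inter> {..z} = \<gamma> \<inter> {..z}"
      and x: "\<And>y. y \<in> set xs \<Longrightarrow> y < x" "z < x"
      by auto
    have "finite (word_act xs \<gamma>)" using assms(2) by simp
    then show ?case
    proof (cases rule: letter_act_cases[where x = x])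
      case greatest
      then show ?thesis using IH x by auto
    next
      case (bump m)
      then have "m \<notin> set xs" "m \<notin> {..z}" using x by fastforce+
      then show ?thesis using IH x bump(4) by auto
    qed
  qed
  then show "set xs \<subseteq> word_act xs \<gamma>" "word_act xs \<gamma> \<inter> {..z} = \<gamma> \<inter> {..z}" by auto
qed

text \<open>The second summand does not depend on \<gamma>, so the cardinality after acting by
  \<open>xs\<close> reveals the number of elements of \<gamma> up to \<open>z\<close>.\<close>

lemma card_act_above:
  fixes A :: "'a::linorder set" and z :: 'a
  assumes "finite A" "\<gamma> \<subseteq> A"
  defines "xs \<equiv> rev (sorted_list_of_set {a \<in> A. z < a})"
  shows "card (word_act xs \<gamma>) = card (\<gamma> \<inter> {..z}) + card {a \<in> A. z < a}"
proof -
  have set_xs: "set xs = {a \<in> A. z < a}" and dec: "sorted_wrt (>) xs"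
    using assms(1) by (simp_all add: xs_def sorted_wrt_rev)
  have fin: "finite \<gamma>" using assms(1,2) finite_subset by blast
  have act: "set xs \<subseteq> word_act xs \<gamma>" "word_act xs \<gamma> \<inter> {..z} = \<gamma> \<inter> {..z}"
    using word_act_decreasing[OF dec fin, of z] set_xs assms(2) by auto
  \<comment> \<open>Above \<open>z\<close> the column thus consists of exactly the letters of
    \<open>xs\<close>.\<close>
  have "word_act xs \<gamma> \<subseteq> A"
    using set_xs assms(2) by (intro word_act_subset) auto
  then have "word_act xs \<gamma> = (word_act xs \<gamma> \<inter> {..z}) \<union> {a \<in> A. z < a}"
    using act(1) set_xs by auto
  also have "\<dots> = (\<gamma> \<inter> {..z}) \<union> {a \<in> A. z < a}"
    using act(2) by simp
  also have "card \<dots> = card (\<gamma> \<inter> {..z}) + card {a \<in> A. z < a}"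
    using fin assms(1) by (intro card_Un_disjoint) auto
  finally show ?thesis .
qed

text \<open>At the least element \<open>z\<close> of the symmetric difference the sets agree
  strictly below \<open>z\<close> and exactly one contains \<open>z\<close>, so the counts up to
  \<open>z\<close> differ by one.\<close>

lemma eq_if_card_atMost_eq:
  fixes \<gamma> \<delta> :: "'a::linorder set"
  assumes fin: "finite \<gamma>" "finite \<delta>" and card: "\<And>z. card (\<gamma> \<inter> {..z}) = card (\<delta> \<inter> {..z})"
  shows "\<gamma> = \<delta>"
proof (rule ccontr)
  let ?S = "(\<gamma> - \<delta>) \<union> (\<delta> - \<gamma>)"
  assume "\<gamma> \<noteq> \<delta>"
  then have ne: "?S \<noteq> {}" by auto
  have finS: "finite ?S" using fin by simp
  define z where "z = Min ?S"
  have z: "z \<in> ?S" and least: "\<And>y. y \<in> ?S \<Longrightarrow> z \<le> y"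
    using Min_in[OF finS ne] Min_le[OF finS] by (simp_all only: z_def)
  have "y \<notin> ?S" if "y < z" for y
    using least[of y] that by (meson not_le)
  then have below: "\<gamma> \<inter> {..<z} = \<delta> \<inter> {..<z}"
    by auto
  have "{..z} = insert z {..<z}"
    by auto
  then have split: "X \<inter> {..z} = (if z \<in> X then insert z (X \<inter> {..<z}) else X \<inter> {..<z})" for X
    by simp
  show False
    using card[of z] z fin unfolding split below by (auto split: if_splits)
qed

lemma word_act_empty_surj:
  fixes A :: "'a::linorder set"
  assumes "finite A" "\<gamma> \<subseteq> A"
  shows "\<exists>w\<in>lists A. word_act w {} = \<gamma>"
proof -
  let ?w = "rev (sorted_list_of_set \<gamma>)"
  \<comment> \<open>Every arriving letter exceeds all present ones, so nothing is bumped.\<close>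
  have act: "word_act xs {} = set xs" if "sorted_wrt (>) xs" for xs :: "'a list"
    using that by (induction xs) (auto simp: letter_act_def)
  have "finite \<gamma>" using assms finite_subset by blast
  then have "word_act ?w {} = \<gamma>" "?w \<in> lists A"
    using assms(2) act[of ?w] by (auto simp: sorted_wrt_rev)
  then show ?thesis by blast
qed

section \<open>The left and two-sided syntactic congruences\<close>

lemma left_syntactic_cong_max_decreasing_iff:
  fixes A :: "'a::linorder set"
  assumes "finite A" "u \<in> lists A" "v \<in> lists A"
  shows "(u, v) \<in> left_syntactic_cong A max_decreasing \<longleftrightarrow> word_act u {} = word_act v {}"
proof
  assume "word_act u {} = word_act v {}"
  then show "(u, v) \<in> left_syntactic_cong A max_decreasing"
    using assms by (simp add: left_syntactic_cong_def max_decreasing_eq_card word_act_append)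
next
  assume *: "(u, v) \<in> left_syntactic_cong A max_decreasing"
  have sub: "word_act u {} \<subseteq> A" "word_act v {} \<subseteq> A"
    using assms by (simp_all add: word_act_subset)
  show "word_act u {} = word_act v {}"
  proof (rule eq_if_card_atMost_eq)
    fix z
    \<comment> \<open>This left context isolates the count up to \<open>z\<close>.\<close>
    let ?xs = "rev (sorted_list_of_set {a \<in> A. z < a})"
    have "?xs \<in> lists A" using assms(1) by auto
    then have "max_decreasing (?xs @ u) = max_decreasing (?xs @ v)"
      using * unfolding left_syntactic_cong_def by blast
    then show "card (word_act u {} \<inter> {..z}) = card (word_act v {} \<inter> {..z})"
      using card_act_above[OF assms(1) sub(1), of z] card_act_above[OF assms(1) sub(2), of z]
      by (simp add: max_decreasing_eq_card word_act_append)
  qed simp_all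
qed

lemma syntactic_cong_max_decreasing:
  fixes A :: "'a::linorder set"
  assumes "finite A"
  shows "syntactic_cong A max_decreasing = styl_cong A"
proof (intro equalityI subrelI)
  fix u v assume "(u, v) \<in> styl_cong A"
  then show "(u, v) \<in> syntactic_cong A max_decreasing"
    by (auto simp: styl_cong_def syntactic_cong_def max_decreasing_eq_card word_act_append
        word_act_subset)
next
  fix u v assume *: "(u, v) \<in> syntactic_cong A max_decreasing"
  then have uv: "u \<in> lists A" "v \<in> lists A"
    by (auto simp: syntactic_cong_def)
  have "word_act u \<gamma> = word_act v \<gamma>" if \<gamma>: "\<gamma> \<subseteq> A" for \<gamma>
  proof -
    \<comment> \<open>Using \<open>y\<close> as right context turns the action on \<gamma> into the
      action of \<open>u @ y\<close> and \<open>v @ y\<close> on the empty column, which the left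
      congruence controls.\<close>
    obtain y where y: "y \<in> lists A" "word_act y {} = \<gamma>"
      using word_act_empty_surj[OF assms \<gamma>] by blast
    have l: "u @ y \<in> lists A" "v @ y \<in> lists A" using uv y by simp_all
    then have "(u @ y, v @ y) \<in> left_syntactic_cong A max_decreasing"
      using * y(1) unfolding left_syntactic_cong_def syntactic_cong_def by blast
    then show ?thesis
      using left_syntactic_cong_max_decreasing_iff[OF assms l] y(2) by (simp add: word_act_append)
  qed
  then show "(u, v) \<in> styl_cong A"
    using uv by (simp add: styl_cong_def)
qed

theorem theorem13p1:
  fixes A :: "'a::linorder set"
  assumes "finite A"
  shows "(\<forall>u\<in>lists A. \<forall>v\<in>lists A.
            (u, v) \<in> left_syntactic_cong A max_decreasing \<longleftrightarrow> word_act u {} = word_act v {})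
       \<and> syntactic_cong A max_decreasing = styl_cong A
       \<and> syntactic_monoid A max_decreasing = Styl A"
  using left_syntactic_cong_max_decreasing_iff[OF assms] syntactic_cong_max_decreasing[OF assms]
  by (simp add: syntactic_monoid_def Styl_def)

end
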